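(* If $E(\lambda)$ is a $*$-anti-palindromic $n\times n$ matrix pencil with $\operatorname{rank}E=r\leq n$, then it can be written as $$E(\lambda)=\big((a_1+b_1\mathfrak i)+\lambda(-a_1+b_1\mathfrak i)\big)u_1u_1^*+\cdots+\big((a_\ell+b_\ell\mathfrak i)+\lambda(-a_\ell+b_\ell\mathfrak i)\big)u_\ell u_\ell^*+v_1w_1^*+\cdots+v_sw_s^*-(\operatorname{rev}w_1)v_1^*-\cdots-(\operatorname{rev}w_s)v_s^*,$$ where $\mathfrak i$ is the imaginary unit, $a_i,b_i\in\mathbb R$ for $i=1,\dots,\ell$, $u_i,v_j,w_j\in\mathbb C[\lambda]^n$, and (i) $\ell+2s=r$; (ii) $\deg u_1=\cdots=\deg u_\ell=0=\deg v_1=\cdots=\deg v_s$ and $\deg w_1,\dots,\deg w_s\leq 1$.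
   Context: A matrix pencil $E(\lambda)=A+\lambda B$ with $A,B\in\mathbb C^{n\times n}$ is $*$-anti-palindromic if $A^*=-B$. Its rank is the normal rank, i.e. the rank as a matrix over the field of rational functions, $\max_{\lambda\in\mathbb C}\operatorname{rank}(A+\lambda B)$. For $v(\lambda)\in\mathbb C[\lambda]^n$, $\deg v$ is the largest degree of the entries of $v$; so $\deg v=0$ means that $v$ is a constant vector in $\mathbb C^n$. For $w(\lambda)=w_0+\lambda w_1$ with $w_0,w_1\in\mathbb C^n$, $w^*$ denotes $w_0^*+\lambda w_1^*$ (conjugate transpose is applied to coefficients only, not to $\lambda$) and $\operatorname{rev}w(\lambda)=w_1+\lambda w_0$. *)

theory Defs
  imports
    "HOL-Analysis.Analysis"
    "HOL-Computational_Algebra.Polynomial_Factorial"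
begin

definition conj_transpose :: "complex^'n^'m \<Rightarrow> complex^'m^'n"
  where "conj_transpose M = (\<chi> i j. cnj (M $ j $ i))"

definition pencil :: "complex^'n^'m \<Rightarrow> complex^'n^'m \<Rightarrow> complex poly^'n^'m"
  where "pencil A B = (\<chi> i j. [:A $ i $ j, B $ i $ j:])"

definition star_anti_palindromic :: "complex poly^'n^'n \<Rightarrow> bool"
  where "star_anti_palindromic E \<longleftrightarrow> (\<exists>A B. E = pencil A B \<and> conj_transpose A = - B)"

text \<open>The rank over the field of rational functions, the latter being the fraction field
  of \<^typ>\<open>complex poly\<close>.\<close>

definition normal_rank :: "complex poly^'n^'m \<Rightarrow> nat"
  where "normal_rank E = rank (map_matrix to_fract E)"

definition vec_degree :: "'a::zero poly^'n \<Rightarrow> nat"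
  where "vec_degree v = Max (range (\<lambda>i. degree (v $ i)))"

text \<open>The entries of the row vector $w^*$: only coefficients are conjugated, not the
  indeterminate.\<close>

definition vec_star :: "complex poly^'n \<Rightarrow> complex poly^'n"
  where "vec_star w = (\<chi> i. map_poly cnj (w $ i))"

text \<open>Reversal with respect to degree 1, meant for vectors of degree at most 1. It differs
  from \<^const>\<open>reflect_poly\<close>, which reverses each entry with respect to its own degree: here a
  constant vector $w_0$ becomes $\lambda w_0$.\<close>

definition vec_rev :: "'a::zero poly^'n \<Rightarrow> 'a poly^'n"
  where "vec_rev w = (\<chi> i. [:coeff (w $ i) 1, coeff (w $ i) 0:])"

text \<open>Product of a column \<open>x\<close> and a row \<open>y\<close>. No conjugation is built in, so $v w^*$ is
  \<open>col_row v (vec_star w)\<close>.\<close>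

definition col_row :: "'a::times^'m \<Rightarrow> 'a^'n \<Rightarrow> 'a^'n^'m"
  where "col_row x y = (\<chi> i j. x $ i * y $ j)"

definition mat_scale :: "'a::times \<Rightarrow> 'a^'n^'m \<Rightarrow> 'a^'n^'m"
  where "mat_scale c M = map_matrix ((*) c) M"

end

theory Submission
  imports Defs "HOL-Computational_Algebra.Fundamental_Theorem_Algebra"
begin

text \<open>
  An anti-palindromic pencil is $A - \lambda A^*$ for a square matrix $A$, and the claim is about
  $A$ alone: up to the pencil notation, $A$ has to be written as a sum of $\ell$ terms
  $c\,u u^*$ and $s$ terms $g v^* + v x^*$, with $\ell + 2s$ equal to the normal rank. The terms are
  split off one at a time, by strong induction on the normal rank.

  The vector that guides a step is a $z$ for which $Az = \alpha v$ and $A^*z = \beta v$ are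
  multiples of a common $v \neq 0$ and not both zero. Such a $z$ exists as soon as
  $A \neq 0$ (\<open>star_pencil_eigenvector\<close>). If some $z$ satisfies $A^*z = 0 \neq Az$, it
  serves. Otherwise $\ker A^* \subseteq \ker A$, hence the range of $A^*$ lies in that of $A$, and
  an eigenvector of the relation $A^*z = \mu A z$ comes from the usual minimal polynomial argument.

  Both steps rest on Wedderburn's rank reduction (\<open>rank_wedderburn_reduction\<close>): subtracting
  $(Mp)(yM)/(yMp)$ from $M$ lowers the rank by exactly one. It is applied to the pencil over the
  field of rational functions, where $z$ gives $Mz = (\alpha - \lambda\beta)\,v$ and
  $z^*M = (\overline\beta - \lambda\overline\alpha)\,v^*$.

  If $v^*z \neq 0$, the reduction with $y = z^*$ and $p = z$ removes a scalar pencil times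
  $v v^*$. The identity $z^*(Az) = (A^*z)^*z$ says exactly that this scalar pencil is
  anti-palindromic (\<open>normal_rank_split_nonisotropic\<close>).

  If $v^*z = 0$, two reductions are made, the first along the row $z^*M$ and the second along the
  column $Mz$. The rational factors cancel, and together they replace $A$ by $(I-Q)A(I-Q)$, where
  $Q$ is the orthogonal projection onto the line spanned by $v$. So the result is again
  anti-palindromic, its normal rank is smaller by two, and
  $A - (I-Q)A(I-Q)$ has the form $g v^* + v x^*$ (\<open>normal_rank_split_isotropic\<close>).
\<close>

section \<open>The Hermitian form and rank-one matrices\<close>

definition cdot :: "complex^'n \<Rightarrow> complex^'n \<Rightarrow> complex"
  where "cdot x y = (\<Sum>i\<in>UNIV. cnj (x $ i) * y $ i)"

text \<open>Unlike \<^const>\<open>col_row\<close>, this conjugates the second vector: it is the matrix $x y^*$.\<close>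
definition dyad :: "complex^'m \<Rightarrow> complex^'n \<Rightarrow> complex^'n^'m"
  where "dyad x y = (\<chi> i j. x $ i * cnj (y $ j))"

lemma conj_transpose_idem [simp]: "conj_transpose (conj_transpose A) = A"
  by (simp add: conj_transpose_def vec_eq_iff)

lemma cdot_conj_transpose: "cdot (A *v x) y = cdot x (conj_transpose A *v y)"
  unfolding cdot_def matrix_vector_mult_def conj_transpose_def
  by (simp add: sum_distrib_left sum_distrib_right mult_ac) (rule sum.swap)

lemma cnj_cdot: "cnj (cdot x y) = cdot y x"
  by (simp add: cdot_def mult.commute)

lemma cdot_scale_right: "cdot x (c *s y) = c * cdot x y"
  by (simp add: cdot_def sum_distrib_left mult_ac)

lemma cdot_scale_left: "cdot (c *s x) y = cnj c * cdot x y"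
  by (simp add: cdot_def sum_distrib_left mult_ac)

lemma inner_vec_eq_Re_sum:
  fixes x y :: "complex^'n"
  shows "inner x y = Re (\<Sum>i\<in>UNIV. x $ i * cnj (y $ i))"
  by (simp add: inner_vec_def inner_complex_def)

lemma cdot_self_nonzero: "v \<noteq> 0 \<Longrightarrow> cdot v v \<noteq> 0"
proof -
  assume "v \<noteq> 0"
  then have "inner v v \<noteq> 0" by simp
  moreover have "inner v v = Re (cdot v v)"
    by (simp add: inner_vec_eq_Re_sum cdot_def mult.commute)
  ultimately show ?thesis by force
qed

lemma conj_transpose_diff: "conj_transpose (A - B) = conj_transpose A - conj_transpose B"
  by (simp add: conj_transpose_def vec_eq_iff)

lemma conj_transpose_uminus: "conj_transpose (- A) = - conj_transpose A"
  by (simp add: conj_transpose_def vec_eq_iff)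

lemma conj_transpose_dyad: "conj_transpose (dyad x y) = dyad y x"
  by (simp add: conj_transpose_def dyad_def vec_eq_iff mult.commute)

lemma dyad_mult: "dyad x y *v z = cdot y z *s x"
  by (simp add: dyad_def cdot_def vec_eq_iff matrix_vector_mult_def sum_distrib_left mult_ac)

lemma uminus_mult_vec: "(- A) *v x = - (A *v x)" for A :: "'a::ring_1^'n^'m"
  by (simp add: vec_eq_iff matrix_vector_mult_def sum_negf)

section \<open>Rank reduction over a field\<close>

text \<open>Wedderburn's rank reduction. The row space of $M$ contains $d$, and
  passing to the difference changes each row by a multiple of $d$ only. Each row of the
  difference annihilates $p$, but $d$ does not; so the row space of $M$ is that of the difference
  plus one further dimension, spanned by $d$. The factor $b$
  allows $d$ to be a constant vector when $yM$ is a polynomial multiple of it.\<close>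
lemma rank_wedderburn_reduction:
  fixes M :: "'a::field^'n^'m"
  assumes yM: "y v* M = b *s d" and b: "b \<noteq> 0"
    and e: "(\<Sum>j\<in>UNIV. d $ j * p $ j) = e" and e0: "e \<noteq> 0"
  shows "rank M = rank (M - mat_scale (1 / e) (col_row (M *v p) d)) + 1"
proof -
  define N where "N = M - mat_scale (1 / e) (col_row (M *v p) d)"
  have rowN: "row i N = row i M - ((M *v p) $ i / e) *s d" for i
    by (simp add: N_def row_def vec_eq_iff mat_scale_def map_matrix_def col_row_def)
  have "(\<Sum>i\<in>UNIV. y $ i *s row i M) = b *s d"
    using yM by (simp add: vec_eq_iff vector_matrix_mult_def row_def mult.commute)
  then have "d = inverse b *s (\<Sum>i\<in>UNIV. y $ i *s row i M)"
    using b by (simp add: vec_eq_iff)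
  also have "\<dots> \<in> vec.span (rows M)"
    by (intro vec.span_scale vec.span_sum vec.span_base) (auto simp: rows_def)
  finally have dM: "d \<in> vec.span (rows M)" .
  have orth: "(\<Sum>j\<in>UNIV. x $ j * p $ j) = 0" if "x \<in> vec.span (rows N)" for x
    using that
  proof (induction rule: vec.span_induct_alt)
    case base
    then show ?case by simp
  next
    case (step c x y)
    then obtain i where x: "x = row i N" by (auto simp: rows_def)
    have "(\<Sum>j\<in>UNIV. x $ j * p $ j) = (M *v p) $ i - ((M *v p) $ i / e) * (\<Sum>j\<in>UNIV. d $ j * p $ j)"
      unfolding x rowN
      by (simp add: left_diff_distrib sum_subtractf sum_distrib_left row_def
          matrix_vector_mult_def mult.assoc)
    then have "(\<Sum>j\<in>UNIV. x $ j * p $ j) = 0" using e e0 by simp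
    moreover have "(\<Sum>j\<in>UNIV. (c *s x + y) $ j * p $ j)
        = c * (\<Sum>j\<in>UNIV. x $ j * p $ j) + (\<Sum>j\<in>UNIV. y $ j * p $ j)"
      by (simp add: algebra_simps sum.distrib sum_distrib_left)
    ultimately show ?case using step by simp
  qed
  have dN: "d \<notin> vec.span (rows N)"
    using orth e e0 by blast
  have "rows M \<subseteq> vec.span (insert d (rows N))"
  proof
    fix x assume "x \<in> rows M"
    then obtain i where x: "x = row i M" by (auto simp: rows_def)
    have "x = row i N + ((M *v p) $ i / e) *s d" by (simp add: x rowN)
    also have "\<dots> \<in> vec.span (insert d (rows N))"
      by (intro vec.span_add vec.span_scale vec.span_base) (auto simp: rows_def)
    finally show "x \<in> vec.span (insert d (rows N))" .
  qed
  moreover have "insert d (rows N) \<subseteq> vec.span (rows M)"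
  proof -
    have "row i N \<in> vec.span (rows M)" for i
      unfolding rowN by (intro vec.span_diff vec.span_scale dM vec.span_base) (auto simp: rows_def)
    then show ?thesis using dM by (auto simp: rows_def)
  qed
  ultimately have "vec.span (rows M) = vec.span (insert d (rows N))"
    by (meson vec.span_minimal vec.subspace_span subset_antisym)
  then have "vec.dim (rows M) = vec.dim (insert d (rows N))"
    by (metis vec.dim_span)
  then show ?thesis
    using dN by (simp add: vec.dim_insert N_def row_rank_def_gen)
qed

section \<open>A common direction of $Az$ and $A^*z$\<close>

text \<open>The real inner product on $\mathbb C^n$ is the real part of the Hermitian form, so
  that $A$ and $A^*$ are adjoint for it too. Orthogonal decomposition for the real inner product
  is thus enough for the range argument that follows.\<close>
lemma inner_conj_transpose:
  fixes A :: "complex^'n^'m"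
  shows "inner (A *v x) y = inner x (conj_transpose A *v y)"
proof -
  have "(\<Sum>i\<in>UNIV. (A *v x) $ i * cnj (y $ i))
      = (\<Sum>i\<in>UNIV. \<Sum>j\<in>UNIV. A $ i $ j * x $ j * cnj (y $ i))"
    by (simp add: matrix_vector_mult_def sum_distrib_right)
  also have "\<dots> = (\<Sum>j\<in>UNIV. \<Sum>i\<in>UNIV. A $ i $ j * x $ j * cnj (y $ i))"
    by (rule sum.swap)
  also have "\<dots> = (\<Sum>j\<in>UNIV. x $ j * cnj ((conj_transpose A *v y) $ j))"
    by (simp add: matrix_vector_mult_def sum_distrib_left conj_transpose_def mult_ac)
  finally show ?thesis
    by (simp add: inner_vec_eq_Re_sum)
qed

text \<open>Split $A^*w = y + z$ with $y$ in the range of $A$ and $z$ orthogonal to it. Then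
  $A^*z = 0$, so $Az = 0$ by assumption, so $z$ is orthogonal to the range of $A^*$ as well, and
  in particular to $A^*w$ itself. Hence $z = 0$.\<close>
lemma conj_transpose_in_range:
  fixes A :: "complex^'n^'n"
  assumes ker: "\<And>z. conj_transpose A *v z = 0 \<Longrightarrow> A *v z = 0"
  shows "\<exists>u. A *v u = conj_transpose A *v w"
proof -
  let ?S = "range ((*v) A)"
  have lin: "linear ((*v) A)"
    by (intro linearI matrix_vector_right_distrib)
      (simp add: vec_eq_iff matrix_vector_mult_def scaleR_sum_right)
  have S: "span ?S = ?S"
    using lin by (intro span_eq_iff[THEN iffD2] linear_subspace_image) auto
  obtain y z where y: "y \<in> ?S" and z: "\<And>w. w \<in> ?S \<Longrightarrow> orthogonal z w"
    and eq: "conj_transpose A *v w = y + z"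
    using orthogonal_subspace_decomp_exists[of ?S "conj_transpose A *v w"] unfolding S by metis
  have "inner x (conj_transpose A *v z) = 0" for x
    using z[of "A *v x"] by (simp add: orthogonal_def inner_commute inner_conj_transpose[symmetric])
  then have "conj_transpose A *v z = 0"
    using inner_eq_zero_iff by blast
  then have "inner z (conj_transpose A *v w) = 0"
    using ker by (simp add: inner_conj_transpose[symmetric])
  moreover have "inner z y = 0" using z[OF y] by (simp add: orthogonal_def)
  ultimately have "z = 0" by (simp add: eq inner_add_right)
  then show ?thesis using y eq by auto
qed

text \<open>For $f_i = T^i w$ with a linear map $T$ this is $p(T)\,w$. Below, $f$ is only a sequence
  with $A f_{i+1} = A^* f_i$; working with the sequence avoids choosing a linear $T$
  with $AT = A^*$.\<close>
definition poly_comb :: "complex poly \<Rightarrow> (nat \<Rightarrow> complex^'n) \<Rightarrow> complex^'n"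
  where "poly_comb p f = (\<Sum>i\<le>degree p. coeff p i *s f i)"

lemma poly_comb_eq_sum:
  assumes "degree p \<le> N"
  shows "poly_comb p f = (\<Sum>i\<le>N. coeff p i *s f i)"
  unfolding poly_comb_def
  using assms by (intro sum.mono_neutral_left) (auto simp: coeff_eq_0)

lemma matrix_poly_comb: "A *v poly_comb p f = poly_comb p (\<lambda>i. A *v f i)"
  by (simp add: poly_comb_def matrix_vector_mult_def vec_eq_iff sum_distrib_left sum_distrib_right
      sum.swap[of _ "{..degree p}"] algebra_simps)

text \<open>The counterpart of $((X - c)\,q)(T)\,w = T\,q(T)\,w - c\,q(T)\,w$, with the shift of the
  sequence in the place of $T$.\<close>
lemma poly_comb_linear_factor:
  "poly_comb ([:- c, 1:] * q) f = poly_comb q (\<lambda>i. f (Suc i)) - c *s poly_comb q f"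
proof (cases "q = 0")
  case False
  let ?d = "degree q"
  have "degree ([:- c, 1:] * q) \<le> Suc ?d"
    using False by (subst degree_mult_eq) auto
  then have "poly_comb ([:- c, 1:] * q) f = (\<Sum>i\<le>Suc ?d. coeff ([:- c, 1:] * q) i *s f i)"
    by (rule poly_comb_eq_sum)
  also have "\<dots> = (\<Sum>i\<le>Suc ?d. (coeff (pCons 0 q) i - c * coeff q i) *s f i)"
    by simp
  also have "\<dots> = (\<Sum>i\<le>Suc ?d. coeff (pCons 0 q) i *s f i) - c *s (\<Sum>i\<le>Suc ?d. coeff q i *s f i)"
    by (simp add: vec.scale_left_diff_distrib sum_subtractf vec.scale_sum_right del: sum.atMost_Suc)
  also have "(\<Sum>i\<le>Suc ?d. coeff (pCons 0 q) i *s f i) = poly_comb q (\<lambda>i. f (Suc i))"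
    by (subst sum.atMost_Suc_shift) (simp add: poly_comb_def)
  also have "(\<Sum>i\<le>Suc ?d. coeff q i *s f i) = poly_comb q f"
    by (rule poly_comb_eq_sum[symmetric]) simp
  finally show ?thesis .
qed (simp add: poly_comb_def)

lemma poly_comb_annihilator:
  fixes f :: "nat \<Rightarrow> complex^'n"
  shows "\<exists>p. p \<noteq> 0 \<and> poly_comb p f = 0"
proof (cases "inj_on f {..CARD('n)}")
  case False
  then obtain i j where ij: "i \<noteq> j" "f i = f j" by (auto simp: inj_on_def)
  let ?p = "monom 1 i - monom 1 j :: complex poly"
  have "?p \<noteq> 0" using ij by (auto simp: poly_eq_iff coeff_monom)
  moreover have "degree ?p \<le> max i j"
    by (intro degree_diff_le order.trans[OF degree_monom_le]) auto
  then have "poly_comb ?p f = (\<Sum>k\<le>max i j. coeff ?p k *s f k)"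
    by (rule poly_comb_eq_sum)
  then have "poly_comb ?p f = (\<Sum>k\<le>max i j. (if k = i then f i else 0) - (if k = j then f j else 0))"
    by (simp, intro sum.cong) (auto simp: vec.scale_left_diff_distrib)
  then have "poly_comb ?p f = 0"
    using ij by (simp add: sum_subtractf)
  ultimately show ?thesis by blast
next
  case True
  let ?S = "f ` {..CARD('n)}"
  have "card ?S = Suc CARD('n)" using True by (simp add: card_image)
  moreover have "vec.dim ?S \<le> CARD('n)"
    using vec.dim_subset[OF subset_UNIV, of ?S] unfolding vec_dim_card .
  ultimately have "vec.dependent ?S"
    by (intro vec.dependent_biggerset_general) auto
  then obtain u w where w: "w \<in> ?S" "u w \<noteq> 0" and s: "(\<Sum>v\<in>?S. u v *s v) = 0"
    by (auto simp: vec.dependent_finite)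
  define p where "p = (\<Sum>i\<le>CARD('n). monom (u (f i)) i)"
  have c: "coeff p i = (if i \<le> CARD('n) then u (f i) else 0)" for i
    by (simp add: p_def coeff_sum)
  have "p \<noteq> 0" using w c by (metis atMost_iff coeff_0 imageE)
  moreover have "degree p \<le> CARD('n)" by (intro degree_le) (simp add: c)
  then have "poly_comb p f = (\<Sum>i\<le>CARD('n). u (f i) *s f i)"
    by (simp add: poly_comb_eq_sum c)
  then have "poly_comb p f = 0"
    using s True by (simp add: sum.reindex)
  ultimately show ?thesis by blast
qed

text \<open>If $A^*z = 0$ forces $Az = 0$, the range argument provides a sequence with
  $A f_{i+1} = A^* f_i$ and $A f_0 \neq 0$. Let $p$ be a polynomial of least degree among the nonzero ones
  for which $A$ kills the combination of the $f_i$ with the coefficients of $p$. Write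
  $p = (X - \mu)\,q$. The combination $z$ that belongs to $q$ then satisfies
  $A^*z - \mu A z = 0$, and minimality of $p$ gives $Az \neq 0$.\<close>
lemma star_pencil_eigenvector:
  fixes A :: "complex^'n^'n"
  assumes "A \<noteq> 0"
  obtains z v \<alpha> \<beta> where "v \<noteq> 0" and "\<alpha> \<noteq> 0 \<or> \<beta> \<noteq> 0"
    and "A *v z = \<alpha> *s v" and "conj_transpose A *v z = \<beta> *s v"
proof (cases "\<exists>z. conj_transpose A *v z = 0 \<and> A *v z \<noteq> 0")
  case True
  then obtain z where "conj_transpose A *v z = 0" "A *v z \<noteq> 0" by blast
  then show ?thesis using that[of "A *v z" 1 0 z] by simp
next
  case False
  then have "\<forall>w. \<exists>u. A *v u = conj_transpose A *v w"
    using conj_transpose_in_range by blast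
  then obtain g where g: "\<And>w. A *v g w = conj_transpose A *v w" by metis
  obtain w where w: "A *v w \<noteq> 0" using assms by (metis matrix_eq matrix_vector_mult_0)
  define f where "f i = (g ^^ i) w" for i
  have Af: "A *v f (Suc i) = conj_transpose A *v f i" for i
    by (simp add: f_def g)
  define P where "P p \<longleftrightarrow> p \<noteq> 0 \<and> A *v poly_comb p f = 0" for p
  have "\<exists>p. P p"
    using poly_comb_annihilator[of f] unfolding P_def by (metis matrix_vector_mult_0_right)
  then obtain p where p: "P p" and pmin: "\<And>q. P q \<Longrightarrow> degree p \<le> degree q"
    using ex_has_least_nat[of P _ degree] by blast
  have "degree p \<noteq> 0"
  proof
    assume "degree p = 0"
    then obtain c where c: "p = [:c:]" by (meson degree_eq_zeroE)
    then have "c \<noteq> 0" and "c *s (A *v w) = 0"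
      using p by (auto simp: P_def poly_comb_def f_def vec.scale)
    then show False using w by simp
  qed
  then obtain \<mu> where "poly p \<mu> = 0"
    using fundamental_theorem_of_algebra[of p] by (auto simp: constant_degree)
  then obtain q where q: "p = [:- \<mu>, 1:] * q" by (metis dvdE poly_eq_0_iff_dvd)
  have q0: "q \<noteq> 0" using p q by (auto simp: P_def)
  have "degree p = Suc (degree q)" unfolding q using q0 by (subst degree_mult_eq) auto
  then have "\<not> P q" using pmin[of q] by auto
  then have z: "A *v poly_comb q f \<noteq> 0" using q0 by (simp add: P_def)
  have "0 = A *v poly_comb p f" using p by (simp add: P_def)
  also have "\<dots> = poly_comb q (\<lambda>i. A *v f (Suc i)) - \<mu> *s poly_comb q (\<lambda>i. A *v f i)"
    unfolding q poly_comb_linear_factor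
    by (simp only: matrix_vector_mult_diff_distrib vec.scale matrix_poly_comb)
  also have "\<dots> = conj_transpose A *v poly_comb q f - \<mu> *s (A *v poly_comb q f)"
    by (simp add: Af matrix_poly_comb)
  finally have "conj_transpose A *v poly_comb q f = \<mu> *s (A *v poly_comb q f)" by simp
  then show ?thesis using that[of "A *v poly_comb q f" 1 \<mu> "poly_comb q f"] z by simp
qed

section \<open>Rank reduction of pencils\<close>

definition fract_vec :: "complex^'n \<Rightarrow> complex poly fract^'n"
  where "fract_vec v = (\<chi> i. to_fract [:v $ i:])"

definition fract_covec :: "complex^'n \<Rightarrow> complex poly fract^'n"
  where "fract_covec v = (\<chi> i. to_fract [:cnj (v $ i):])"

lemma sum_linear_poly: "(\<Sum>i\<in>S. [:a i, b i:]) = [:\<Sum>i\<in>S. a i, \<Sum>i\<in>S. b i:]"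
  by (induction S rule: infinite_finite_induct) auto

lemma sum_const_poly: "(\<Sum>i\<in>S. [:a i:]) = [:\<Sum>i\<in>S. a i:]"
  by (induction S rule: infinite_finite_induct) auto

lemma pencil_mult_fract_vec:
  "map_matrix to_fract (pencil A B) *v fract_vec z
    = (\<chi> i. to_fract [:(A *v z) $ i, (B *v z) $ i:])"
  by (simp add: vec_eq_iff matrix_vector_mult_def map_matrix_def pencil_def fract_vec_def
      flip: to_fract_mult to_fract_sum sum_linear_poly)
    (simp add: mult.commute)

lemma fract_covec_mult_pencil:
  "fract_covec y v* map_matrix to_fract (pencil A B)
    = (\<chi> j. to_fract [:cnj ((conj_transpose A *v y) $ j), cnj ((conj_transpose B *v y) $ j):])"
  by (simp add: vec_eq_iff matrix_vector_mult_def vector_matrix_mult_def map_matrix_def pencil_def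
      fract_covec_def conj_transpose_def flip: to_fract_mult to_fract_sum sum_linear_poly)

lemma fract_covec_dot_fract_vec:
  "(\<Sum>i\<in>UNIV. fract_covec x $ i * fract_vec y $ i) = to_fract [:cdot x y:]"
  by (simp add: fract_covec_def fract_vec_def cdot_def flip: to_fract_mult to_fract_sum sum_const_poly)
    (simp add: mult.commute)

lemma one_div_to_fract_const:
  assumes "e \<noteq> 0"
  shows "1 / to_fract [:e:] = to_fract [:1 / e :: complex:]"
proof -
  have "to_fract [:1 / e:] * to_fract [:e:] = to_fract 1"
    using assms by (simp add: pCons_one flip: to_fract_mult)
  then show ?thesis using assms by (simp add: divide_eq_eq)
qed

text \<open>The hypotheses on $z$ say that the row $z^*(A + \lambda B)$ is the nonzero polynomial
  $\overline a + \lambda\overline b$ times the constant row $v^*$. Since the reduction divides out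
  this polynomial, what is left is again a pencil with constant coefficients.\<close>
lemma normal_rank_pencil_row_drop:
  assumes zA: "conj_transpose A *v z = a *s v" and zB: "conj_transpose B *v z = b *s v"
    and ab: "a \<noteq> 0 \<or> b \<noteq> 0" and e: "cdot v p \<noteq> 0"
  shows "normal_rank (pencil A B)
    = normal_rank (pencil (A - dyad ((1 / cdot v p) *s (A *v p)) v)
                          (B - dyad ((1 / cdot v p) *s (B *v p)) v)) + 1"
proof -
  let ?M = "map_matrix to_fract (pencil A B)" and ?e = "to_fract [:cdot v p:]"
  have y: "fract_covec z v* ?M = to_fract [:cnj a, cnj b:] *s fract_covec v"
    unfolding fract_covec_mult_pencil zA zB
    by (simp add: vec_eq_iff fract_covec_def flip: to_fract_mult)
  have "rank ?M = rank (?M - mat_scale (1 / ?e) (col_row (?M *v fract_vec p) (fract_covec v))) + 1"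
    using ab e by (intro rank_wedderburn_reduction[OF y _ fract_covec_dot_fract_vec]) auto
  also have "?M - mat_scale (1 / ?e) (col_row (?M *v fract_vec p) (fract_covec v))
      = map_matrix to_fract (pencil (A - dyad ((1 / cdot v p) *s (A *v p)) v)
                          (B - dyad ((1 / cdot v p) *s (B *v p)) v))"
    unfolding one_div_to_fract_const[OF e] pencil_mult_fract_vec
    by (simp add: vec_eq_iff mat_scale_def map_matrix_def col_row_def pencil_def dyad_def
        fract_covec_def mult_ac flip: to_fract_mult to_fract_diff)
  finally show ?thesis by (simp add: normal_rank_def)
qed

text \<open>The mirror image: here the column $(A + \lambda B)z$ is a nonzero polynomial times
  $v$. The polynomial occurs in both numerator and denominator of the Wedderburn correction and
  cancels.\<close>
lemma normal_rank_pencil_column_drop: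
  assumes Az: "A *v z = a *s v" and Bz: "B *v z = b *s v"
    and ab: "a \<noteq> 0 \<or> b \<noteq> 0" and e: "cdot q v \<noteq> 0"
  shows "normal_rank (pencil A B)
    = normal_rank (pencil (A - dyad v ((1 / cnj (cdot q v)) *s (conj_transpose A *v q)))
                          (B - dyad v ((1 / cnj (cdot q v)) *s (conj_transpose B *v q)))) + 1"
proof -
  let ?M = "map_matrix to_fract (pencil A B)" and ?e = "to_fract [:cdot q v:]"
    and ?s = "to_fract [:a, b:]"
  let ?d = "fract_covec q v* ?M"
  have Mz: "?M *v fract_vec z = ?s *s fract_vec v"
    unfolding pencil_mult_fract_vec Az Bz
    by (simp add: vec_eq_iff fract_vec_def flip: to_fract_mult)
  have "(\<Sum>j\<in>UNIV. ?d $ j * fract_vec z $ j)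
      = (\<Sum>i\<in>UNIV. fract_covec q $ i * (?M *v fract_vec z) $ i)"
    unfolding vector_matrix_mult_def matrix_vector_mult_def
    by (simp add: sum_distrib_left sum_distrib_right mult_ac) (rule sum.swap)
  also have "\<dots> = ?s * ?e"
    unfolding Mz fract_covec_dot_fract_vec[symmetric] by (simp add: sum_distrib_left mult_ac)
  finally have d: "(\<Sum>j\<in>UNIV. ?d $ j * fract_vec z $ j) = ?s * ?e" .
  have "rank ?M = rank (?M - mat_scale (1 / (?s * ?e)) (col_row (?M *v fract_vec z) ?d)) + 1"
    using ab e by (intro rank_wedderburn_reduction[where b = 1, OF _ _ d]) auto
  also have "mat_scale (1 / (?s * ?e)) (col_row (?M *v fract_vec z) ?d)
      = mat_scale (1 / ?e) (col_row (fract_vec v) ?d)"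
    using ab unfolding Mz by (auto simp: vec_eq_iff mat_scale_def map_matrix_def col_row_def)
  also have "?M - \<dots>
      = map_matrix to_fract (pencil (A - dyad v ((1 / cnj (cdot q v)) *s (conj_transpose A *v q)))
                          (B - dyad v ((1 / cnj (cdot q v)) *s (conj_transpose B *v q))))"
    unfolding one_div_to_fract_const[OF e] fract_covec_mult_pencil
    by (simp add: vec_eq_iff mat_scale_def map_matrix_def col_row_def pencil_def dyad_def
        fract_vec_def mult_ac flip: to_fract_mult to_fract_diff)
  finally show ?thesis by (simp add: normal_rank_def)
qed

section \<open>Splitting one term off an anti-palindromic pencil\<close>

definition skew_pencil :: "complex^'n^'n \<Rightarrow> complex poly^'n^'n"
  where "skew_pencil A = pencil A (- conj_transpose A)"

text \<open>The reduced pencil has constant term $A - \frac{\alpha}{v^*z} v v^*$ and linear term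
  $-A^* + \frac{\beta}{v^*z} v v^*$. It is anti-palindromic because the two scalars
  are conjugate, and this is the adjointness relation $(Az)^*z = z^*(A^*z)$.\<close>
lemma normal_rank_split_nonisotropic:
  assumes Az: "A *v z = \<alpha> *s v" and Az': "conj_transpose A *v z = \<beta> *s v"
    and ab: "\<alpha> \<noteq> 0 \<or> \<beta> \<noteq> 0" and e: "cdot v z \<noteq> 0"
  shows "normal_rank (skew_pencil A)
    = normal_rank (skew_pencil (A - dyad ((\<alpha> / cdot v z) *s v) v)) + 1"
proof -
  have "\<beta> * cnj (cdot v z) = cnj \<alpha> * cdot v z"
    using cdot_conj_transpose[of A z z] unfolding Az Az'
    by (simp add: cdot_scale_left cdot_scale_right cnj_cdot)
  then have conjugate: "\<beta> / cdot v z = cnj (\<alpha> / cdot v z)"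
    using e by (simp add: field_simps)
  have Cz: "conj_transpose (- conj_transpose A) *v z = (- \<alpha>) *s v"
    by (simp add: conj_transpose_uminus uminus_mult_vec Az)
  have "normal_rank (skew_pencil A)
    = normal_rank (pencil (A - dyad ((1 / cdot v z) *s (A *v z)) v)
        (- conj_transpose A - dyad ((1 / cdot v z) *s ((- conj_transpose A) *v z)) v)) + 1"
    unfolding skew_pencil_def by (rule normal_rank_pencil_row_drop[OF Az' Cz _ e]) (use ab in auto)
  also have "(1 / cdot v z) *s (A *v z) = (\<alpha> / cdot v z) *s v"
    by (simp add: Az)
  also have "- conj_transpose A - dyad ((1 / cdot v z) *s ((- conj_transpose A) *v z)) v
      = - conj_transpose (A - dyad ((\<alpha> / cdot v z) *s v) v)"
    using conjugate by (simp add: uminus_mult_vec Az' conj_transpose_diff conj_transpose_dyad)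
      (simp add: vec_eq_iff dyad_def)
  finally show ?thesis by (simp add: skew_pencil_def)
qed

text \<open>Because $v^*z = 0$, the first reduction leaves $Az$ and $A^*z$ unchanged, so that the
  second one still finds the direction $v$. Together they send $A$ to $(I-Q)A(I-Q)$ with
  $Q = v v^*/(v^*v)$; in general the pencil is anti-palindromic again only after
  both.\<close>
lemma normal_rank_split_isotropic:
  assumes Az: "A *v z = \<alpha> *s v" and Az': "conj_transpose A *v z = \<beta> *s v"
    and ab: "\<alpha> \<noteq> 0 \<or> \<beta> \<noteq> 0" and v: "v \<noteq> 0" and e: "cdot v z = 0"
  shows "\<exists>g x. normal_rank (skew_pencil A)
    = normal_rank (skew_pencil (A - (dyad g v + dyad v x))) + 2"
proof -
  define n where "n = cdot v v"
  define B where "B = - conj_transpose A"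
  define A1 where "A1 = A - dyad ((1 / n) *s (A *v v)) v"
  define B1 where "B1 = B - dyad ((1 / n) *s (B *v v)) v"
  define A2 where "A2 = A1 - dyad v ((1 / n) *s (conj_transpose A1 *v v))"
  define B2 where "B2 = B1 - dyad v ((1 / n) *s (conj_transpose B1 *v v))"
  have n: "n \<noteq> 0" and n_real: "cnj n = n"
    using v by (auto simp: n_def cdot_self_nonzero cnj_cdot)
  have cB: "conj_transpose B = - A" by (simp add: B_def conj_transpose_uminus)
  have Cz: "conj_transpose B *v z = (- \<alpha>) *s v"
    by (simp add: cB uminus_mult_vec Az)
  have "normal_rank (pencil A B) = normal_rank (pencil A1 B1) + 1"
    unfolding A1_def B1_def n_def
    by (rule normal_rank_pencil_row_drop[OF Az' Cz]) (use ab n in \<open>auto simp: n_def\<close>)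
  also have "normal_rank (pencil A1 B1) = normal_rank (pencil A2 B2) + 1"
  proof -
    have A1z: "A1 *v z = \<alpha> *s v" and B1z: "B1 *v z = (- \<beta>) *s v"
      by (simp_all add: A1_def B1_def B_def matrix_vector_mult_diff_rdistrib dyad_mult e Az Az' uminus_mult_vec)
    have "normal_rank (pencil A1 B1) = normal_rank (pencil
        (A1 - dyad v ((1 / cnj (cdot v v)) *s (conj_transpose A1 *v v)))
        (B1 - dyad v ((1 / cnj (cdot v v)) *s (conj_transpose B1 *v v)))) + 1"
      by (rule normal_rank_pencil_column_drop[OF A1z B1z]) (use ab n in \<open>auto simp: n_def\<close>)
    then show ?thesis using n_real by (simp add: A2_def B2_def n_def)
  qed
  finally have rank: "normal_rank (skew_pencil A) = normal_rank (pencil A2 B2) + 2"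
    by (simp add: skew_pencil_def B_def)
  \<comment> \<open>In $QA + AQ - QAQ$ the term $QAQ = \overline k\,v v^*$ may be assigned to either of the
    two factors of the pair; here it goes to the one multiplied by $v$ from the left.\<close>
  define g h k where "g = (1 / n) *s (A *v v)" and "h = (1 / n) *s (conj_transpose A *v v)"
    and "k = cdot (A *v v) v / (n * n)"
  have A2: "A2 = A - (dyad g v + dyad v (h - k *s v))"
    by (simp add: A2_def A1_def conj_transpose_diff conj_transpose_dyad
        matrix_vector_mult_diff_rdistrib dyad_mult cdot_scale_left n_real g_def h_def k_def)
  have k: "cdot (conj_transpose A *v v) v / (n * n) = cnj k"
    by (simp add: k_def n_real cnj_cdot cdot_conj_transpose)
  have "B2 = - conj_transpose A + dyad h v + dyad v (g - cnj k *s v)"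
    unfolding k[symmetric]
    by (simp add: B2_def B1_def cB conj_transpose_diff conj_transpose_dyad
        matrix_vector_mult_diff_rdistrib dyad_mult cdot_scale_left n_real g_def h_def uminus_mult_vec)
      (simp add: vec_eq_iff dyad_def algebra_simps n_real B_def uminus_mult_vec cdot_def sum_negf)
  also have "\<dots> = - conj_transpose A2"
    by (simp add: A2) (simp add: vec_eq_iff dyad_def conj_transpose_def algebra_simps)
  finally show ?thesis
    using rank A2 by (auto simp: skew_pencil_def)
qed

section \<open>Collecting the terms\<close>

text \<open>The pencil and the number of terms, counted with weight 2 for a pair, are parameters: the
  induction appends terms to the decomposition of a pencil of smaller rank.\<close>
definition anti_palindromic_decomposition :: "complex poly^'n^'n \<Rightarrow> nat \<Rightarrow> bool"
  where "anti_palindromic_decomposition E r \<longleftrightarrow>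
    (\<exists>(l::nat) (s::nat) (a::nat \<Rightarrow> real) (b::nat \<Rightarrow> real)
      (u::nat \<Rightarrow> complex poly^'n) (v::nat \<Rightarrow> complex poly^'n) (w::nat \<Rightarrow> complex poly^'n).
    E = (\<Sum>i=1..l. mat_scale
            [:of_real (a i) + of_real (b i) * \<i>, - of_real (a i) + of_real (b i) * \<i>:]
            (col_row (u i) (vec_star (u i))))
        + (\<Sum>j=1..s. col_row (v j) (vec_star (w j)))
        - (\<Sum>j=1..s. col_row (vec_rev (w j)) (vec_star (v j)))
    \<and> l + 2 * s = r
    \<and> (\<forall>i\<in>{1..l}. vec_degree (u i) = 0)
    \<and> (\<forall>j\<in>{1..s}. vec_degree (v j) = 0)
    \<and> (\<forall>j\<in>{1..s}. vec_degree (w j) \<le> 1))"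

lemma decomposition_zero: "anti_palindromic_decomposition 0 0"
  unfolding anti_palindromic_decomposition_def by (intro exI[of _ 0]) auto

lemma decomposition_add_scaled_square:
  assumes "anti_palindromic_decomposition E r" and x: "vec_degree x = 0"
  shows "anti_palindromic_decomposition
    (E + mat_scale [:of_real c + of_real d * \<i>, - of_real c + of_real d * \<i>:]
          (col_row x (vec_star x))) (r + 1)"
proof -
  let ?q = "\<lambda>c d x. mat_scale
      [:complex_of_real c + of_real d * \<i>, - of_real c + of_real d * \<i>:] (col_row x (vec_star x))"
  obtain l s a b u v w where E: "E = (\<Sum>i=1..l. ?q (a i) (b i) (u i))
        + (\<Sum>j=1..s. col_row (v j) (vec_star (w j)))
        - (\<Sum>j=1..s. col_row (vec_rev (w j)) (vec_star (v j)))"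
    and *: "l + 2 * s = r" "\<forall>i\<in>{1..l}. vec_degree (u i) = 0"
      "\<forall>j\<in>{1..s}. vec_degree (v j) = 0" "\<forall>j\<in>{1..s}. vec_degree (w j) \<le> 1"
    using assms(1) unfolding anti_palindromic_decomposition_def by (elim exE conjE) (rule that)
  let ?a = "a(Suc l := c)" and ?b = "b(Suc l := d)" and ?u = "u(Suc l := x)"
  have "(\<Sum>i=1..Suc l. ?q (?a i) (?b i) (?u i)) = (\<Sum>i=1..l. ?q (a i) (b i) (u i)) + ?q c d x"
    by (simp add: sum.cl_ivl_Suc)
  note new_sum = this
  have regroup: "e + f - g + h = e + h + f - g" for e f g h :: "complex poly^'n^'n"
    by (simp add: algebra_simps)
  have "E + ?q c d x = (\<Sum>i=1..Suc l. ?q (?a i) (?b i) (?u i))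
        + (\<Sum>j=1..s. col_row (v j) (vec_star (w j)))
        - (\<Sum>j=1..s. col_row (vec_rev (w j)) (vec_star (v j)))"
    unfolding E new_sum by (rule regroup)
  moreover have "Suc l + 2 * s = r + 1" "\<forall>i\<in>{1..Suc l}. vec_degree (?u i) = 0"
    using * x by auto
  ultimately show ?thesis
    unfolding anti_palindromic_decomposition_def using *(3,4) by blast
qed

lemma decomposition_add_pair:
  assumes "anti_palindromic_decomposition E r" and x: "vec_degree x = 0" and y: "vec_degree y \<le> 1"
  shows "anti_palindromic_decomposition
    (E + col_row x (vec_star y) - col_row (vec_rev y) (vec_star x)) (r + 2)"
proof -
  let ?q = "\<lambda>c d x. mat_scale
      [:complex_of_real c + of_real d * \<i>, - of_real c + of_real d * \<i>:] (col_row x (vec_star x))"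
  obtain l s a b u v w where E: "E = (\<Sum>i=1..l. ?q (a i) (b i) (u i))
        + (\<Sum>j=1..s. col_row (v j) (vec_star (w j)))
        - (\<Sum>j=1..s. col_row (vec_rev (w j)) (vec_star (v j)))"
    and *: "l + 2 * s = r" "\<forall>i\<in>{1..l}. vec_degree (u i) = 0"
      "\<forall>j\<in>{1..s}. vec_degree (v j) = 0" "\<forall>j\<in>{1..s}. vec_degree (w j) \<le> 1"
    using assms(1) unfolding anti_palindromic_decomposition_def by (elim exE conjE) (rule that)
  let ?v = "v(Suc s := x)" and ?w = "w(Suc s := y)"
  have "(\<Sum>j=1..Suc s. col_row (?v j) (vec_star (?w j)))
        = (\<Sum>j=1..s. col_row (v j) (vec_star (w j))) + col_row x (vec_star y)"
    "(\<Sum>j=1..Suc s. col_row (vec_rev (?w j)) (vec_star (?v j)))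
        = (\<Sum>j=1..s. col_row (vec_rev (w j)) (vec_star (v j))) + col_row (vec_rev y) (vec_star x)"
    by (simp_all add: sum.cl_ivl_Suc)
  note new_sums = this
  have regroup: "e + f - g + h - k = e + (f + h) - (g + k)" for e f g h k :: "complex poly^'n^'n"
    by (simp add: algebra_simps)
  have "E + col_row x (vec_star y) - col_row (vec_rev y) (vec_star x)
      = (\<Sum>i=1..l. ?q (a i) (b i) (u i))
        + (\<Sum>j=1..Suc s. col_row (?v j) (vec_star (?w j)))
        - (\<Sum>j=1..Suc s. col_row (vec_rev (?w j)) (vec_star (?v j)))"
    unfolding E new_sums by (rule regroup)
  moreover have "l + 2 * Suc s = r + 2" "\<forall>j\<in>{1..Suc s}. vec_degree (?v j) = 0"
    "\<forall>j\<in>{1..Suc s}. vec_degree (?w j) \<le> 1"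
    using * x y by auto
  ultimately show ?thesis
    unfolding anti_palindromic_decomposition_def using *(2) by blast
qed

lemma vec_degree_le_iff: "vec_degree v \<le> k \<longleftrightarrow> (\<forall>i. degree (v $ i) \<le> k)"
  by (auto simp: vec_degree_def)

definition const_vec :: "complex^'n \<Rightarrow> complex poly^'n"
  where "const_vec v = (\<chi> i. [:v $ i:])"

lemma vec_degree_const_vec: "vec_degree (const_vec v) = 0"
  using vec_degree_le_iff[of "const_vec v" 0] by (simp add: const_vec_def)

lemma skew_pencil_add_scaled_square:
  "skew_pencil (A + dyad (c *s v) v) = skew_pencil A
    + mat_scale [:of_real (Re c) + of_real (Im c) * \<i>, - of_real (Re c) + of_real (Im c) * \<i>:]
        (col_row (const_vec v) (vec_star (const_vec v)))"
proof -
  have c: "of_real (Re c) + of_real (Im c) * \<i> = c" "- of_real (Re c) + of_real (Im c) * \<i> = - cnj c"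
    by (simp_all add: complex_eq_iff)
  show ?thesis
    unfolding c by (simp add: vec_eq_iff skew_pencil_def pencil_def dyad_def conj_transpose_def mat_scale_def
        map_matrix_def col_row_def const_vec_def vec_star_def map_poly_pCons algebra_simps)
qed

text \<open>In the notation $w = w_0 + \lambda w_1$ of a pair, $x = w_0$ and $g = -w_1$: the
  constant coefficient of $v w^* - (\mathrm{rev}\,w) v^*$ is $v w_0^* - w_1 v^*$.\<close>
lemma skew_pencil_add_pair:
  fixes A :: "complex^'n^'n"
  defines "W \<equiv> (\<lambda>x g. \<chi> i. [:x $ i, - (g $ i):]) :: complex^'n \<Rightarrow> complex^'n \<Rightarrow> complex poly^'n"
  shows "skew_pencil (A + (dyad g v + dyad v x)) = skew_pencil A
    + col_row (const_vec v) (vec_star (W x g)) - col_row (vec_rev (W x g)) (vec_star (const_vec v))"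
  by (simp add: W_def vec_eq_iff skew_pencil_def pencil_def dyad_def conj_transpose_def
        col_row_def const_vec_def vec_star_def vec_rev_def map_poly_pCons algebra_simps)

lemma skew_pencil_decomposition:
  fixes A :: "complex^'n^'n"
  shows "anti_palindromic_decomposition (skew_pencil A) (normal_rank (skew_pencil A))"
proof (induction "normal_rank (skew_pencil A)" arbitrary: A rule: less_induct)
  case less
  show ?case
  proof (cases "A = 0")
    case True
    have "skew_pencil (0 :: complex^'n^'n) = 0"
      by (simp add: skew_pencil_def pencil_def conj_transpose_def vec_eq_iff)
    moreover have "normal_rank (0 :: complex poly^'n^'n) = 0"
    proof -
      have "rows (map_matrix to_fract (0 :: complex poly^'n^'n)) = {0}"
        by (auto simp: rows_def row_def map_matrix_def vec_eq_iff)
      then show ?thesis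
        by (simp add: normal_rank_def row_rank_def_gen vec.dim_insert)
    qed
    ultimately show ?thesis using True decomposition_zero by simp
  next
    case False
    then obtain z v \<alpha> \<beta> where v: "v \<noteq> 0" and ab: "\<alpha> \<noteq> 0 \<or> \<beta> \<noteq> 0"
      and Az: "A *v z = \<alpha> *s v" and Az': "conj_transpose A *v z = \<beta> *s v"
      by (rule star_pencil_eigenvector)
    show ?thesis
    proof (cases "cdot v z = 0")
      case False
      define c where "c = \<alpha> / cdot v z"
      define A' where "A' = A - dyad (c *s v) v"
      have rank: "normal_rank (skew_pencil A) = normal_rank (skew_pencil A') + 1"
        using normal_rank_split_nonisotropic[OF Az Az' ab False] by (simp add: A'_def c_def)
      then have "anti_palindromic_decomposition (skew_pencil A') (normal_rank (skew_pencil A'))"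
        by (intro less) simp
      then show ?thesis
        using decomposition_add_scaled_square[OF _ vec_degree_const_vec]
          skew_pencil_add_scaled_square[of A' c v] rank by (simp add: A'_def)
    next
      case True
      obtain g x where rank: "normal_rank (skew_pencil A)
          = normal_rank (skew_pencil (A - (dyad g v + dyad v x))) + 2"
        using normal_rank_split_isotropic[OF Az Az' ab v True] by blast
      define A' where "A' = A - (dyad g v + dyad v x)"
      have A: "A = A' + (dyad g v + dyad v x)" by (simp add: A'_def)
      have "anti_palindromic_decomposition (skew_pencil A') (normal_rank (skew_pencil A'))"
        using rank unfolding A'_def by (intro less) simp
      moreover have "vec_degree (\<chi> i. [:x $ i, - (g $ i):]) \<le> 1"
        by (simp add: vec_degree_le_iff)
      ultimately have "anti_palindromic_decomposition (skew_pencil A) (normal_rank (skew_pencil A') + 2)"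
        unfolding A skew_pencil_add_pair using decomposition_add_pair vec_degree_const_vec by blast
      then show ?thesis using rank by (simp add: A'_def)
    qed
  qed
qed

theorem theorem14:
  fixes E :: "complex poly^'n^'n" and r :: nat
  assumes "star_anti_palindromic E"
    and "normal_rank E = r" and "r \<le> CARD('n)"
  shows "\<exists>(l::nat) (s::nat) (a::nat \<Rightarrow> real) (b::nat \<Rightarrow> real)
      (u::nat \<Rightarrow> complex poly^'n) (v::nat \<Rightarrow> complex poly^'n) (w::nat \<Rightarrow> complex poly^'n).
    E = (\<Sum>i=1..l. mat_scale
            [:of_real (a i) + of_real (b i) * \<i>, - of_real (a i) + of_real (b i) * \<i>:]
            (col_row (u i) (vec_star (u i))))
        + (\<Sum>j=1..s. col_row (v j) (vec_star (w j)))
        - (\<Sum>j=1..s. col_row (vec_rev (w j)) (vec_star (v j)))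
    \<and> l + 2 * s = r
    \<and> (\<forall>i\<in>{1..l}. vec_degree (u i) = 0)
    \<and> (\<forall>j\<in>{1..s}. vec_degree (v j) = 0)
    \<and> (\<forall>j\<in>{1..s}. vec_degree (w j) \<le> 1)"
proof -
  obtain A where "E = skew_pencil A"
    using assms(1) unfolding star_anti_palindromic_def skew_pencil_def by (metis minus_minus)
  then show ?thesis
    using skew_pencil_decomposition[of A] assms(2)
    unfolding anti_palindromic_decomposition_def by simp
qed

end
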